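(* A formula $\varphi\in\mathrm{PL}(\{\veebar,\wedge,\vee,\mathbin{\dot\vee}\},\Phi)$ is local if and only if it is equivalent to its relaxation $\varphi^{\mathrm{lax}}$.
   Context: A domain $\Phi$ is a finite set of propositional variables (from an infinite supply); a $\Phi$-assignment is a map $s:\Phi\to\{0,1\}$; a $\Phi$-team is a set of $\Phi$-assignments. A split of $T$ is $(T_1,T_2)$ with $T_1,T_2\subseteq T$, $T_1\cup T_2=T$; strict if $T_1\cap T_2=\emptyset$. $\mathrm{PL}(\Sigma,\Phi)$ is the set of formulas built from the literals $\top,\bot,{\sim}\top,{\sim}\bot,p,\neg p,{\sim}p,{\sim}\neg p$ ($p\in\Phi$) by connectives in $\Sigma$. Semantics: $T\models\top$ always; $T\models\bot$ iff $T=\emptyset$; $T\models p$ iff $s(p)=1$ for all $s\in T$; $T\models\neg p$ iff $s(p)=0$ for all $s\in T$; $T\models{\sim}\ell$ iff $T\not\models\ell$; $\wedge$ conjunction; $T\models\psi\veebar\theta$ iff $T\models\psi$ or $T\models\theta$; $T\models\psi\vee\theta$ iff some split $(S,U)$ of $T$ has $S\models\psi$, $U\models\theta$; $\mathbin{\dot\vee}$ likewise with strict splits. For a $\Psi$-team $T$ and $\Phi\subseteq\Psi$, $T\restriction\Phi=\{s\restriction\Phi:s\in T\}$. A formula $\varphi\in\mathrm{PL}(\Sigma,\Phi)$ is local if for every domain $\Psi\supseteq\Phi$ and every $\Psi$-team $T$: $T\models\varphi$ iff $T\restriction\Phi\models\varphi$. Two formulas are equivalent if, for every domain containing all their variables,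 they are satisfied by the same teams. The relaxation $\varphi^{\mathrm{lax}}$ of $\varphi$ is obtained by replacing every occurrence of $\mathbin{\dot\vee}$ by $\vee$. *)

theory Defs
  imports Main
begin

datatype 'p atom = Top | Bot | Pos 'p | Neg 'p

datatype conn = Con_And | Con_BoolOr | Con_Or | Con_StrictOr

text \<open>\<open>Lit a\<close> and \<open>CLit a\<close> are the literals \<open>a\<close> and \<open>\<sim>a\<close>, where
  \<open>a\<close> is one of \<open>\<top>, \<bottom>, p, \<not>p\<close>.\<close>

datatype 'p form =
    Lit "'p atom"
  | CLit "'p atom"
  | Conn conn "'p form" "'p form"

abbreviation vars :: "'p form \<Rightarrow> 'p set" where
  "vars \<equiv> set_form"

inductive_set PL :: "conn set \<Rightarrow> 'p set \<Rightarrow> 'p form set"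
  for \<Sigma> :: "conn set" and \<Phi> :: "'p set" where
  PL_Lit: "set_atom a \<subseteq> \<Phi> \<Longrightarrow> Lit a \<in> PL \<Sigma> \<Phi>"
| PL_CLit: "set_atom a \<subseteq> \<Phi> \<Longrightarrow> CLit a \<in> PL \<Sigma> \<Phi>"
| PL_Conn: "c \<in> \<Sigma> \<Longrightarrow> \<phi> \<in> PL \<Sigma> \<Phi> \<Longrightarrow> \<psi> \<in> PL \<Sigma> \<Phi> \<Longrightarrow> Conn c \<phi> \<psi> \<in> PL \<Sigma> \<Phi>"

text \<open>A \<open>\<Phi>\<close>-assignment is a partial map whose domain is exactly \<open>\<Phi>\<close>.\<close>

type_synonym 'p assignment = "'p \<rightharpoonup> bool"
type_synonym 'p team = "'p assignment set"

definition is_domain :: "'p set \<Rightarrow> bool" where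
  "is_domain \<Phi> \<longleftrightarrow> finite \<Phi>"

definition is_team :: "'p set \<Rightarrow> 'p team \<Rightarrow> bool" where
  "is_team \<Phi> T \<longleftrightarrow> (\<forall>s\<in>T. dom s = \<Phi>)"

definition is_split :: "'p team \<Rightarrow> 'p team \<Rightarrow> 'p team \<Rightarrow> bool" where
  "is_split T T1 T2 \<longleftrightarrow> T1 \<subseteq> T \<and> T2 \<subseteq> T \<and> T1 \<union> T2 = T"

definition is_strict_split :: "'p team \<Rightarrow> 'p team \<Rightarrow> 'p team \<Rightarrow> bool" where
  "is_strict_split T T1 T2 \<longleftrightarrow> is_split T T1 T2 \<and> T1 \<inter> T2 = {}"

fun sat_atom :: "'p team \<Rightarrow> 'p atom \<Rightarrow> bool" where
  "sat_atom T Top \<longleftrightarrow> True"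
| "sat_atom T Bot \<longleftrightarrow> T = {}"
| "sat_atom T (Pos p) \<longleftrightarrow> (\<forall>s\<in>T. s p = Some True)"
| "sat_atom T (Neg p) \<longleftrightarrow> (\<forall>s\<in>T. s p = Some False)"

fun sat :: "'p team \<Rightarrow> 'p form \<Rightarrow> bool"  (infix \<open>\<Turnstile>\<close> 50) where
  "T \<Turnstile> Lit a \<longleftrightarrow> sat_atom T a"
| "T \<Turnstile> CLit a \<longleftrightarrow> \<not> sat_atom T a"
| "T \<Turnstile> Conn Con_And \<phi> \<psi> \<longleftrightarrow> T \<Turnstile> \<phi> \<and> T \<Turnstile> \<psi>"
| "T \<Turnstile> Conn Con_BoolOr \<phi> \<psi> \<longleftrightarrow> T \<Turnstile> \<phi> \<or> T \<Turnstile> \<psi>"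
| "T \<Turnstile> Conn Con_Or \<phi> \<psi> \<longleftrightarrow> (\<exists>S U. is_split T S U \<and> S \<Turnstile> \<phi> \<and> U \<Turnstile> \<psi>)"
| "T \<Turnstile> Conn Con_StrictOr \<phi> \<psi> \<longleftrightarrow> (\<exists>S U. is_strict_split T S U \<and> S \<Turnstile> \<phi> \<and> U \<Turnstile> \<psi>)"

definition team_restrict :: "'p team \<Rightarrow> 'p set \<Rightarrow> 'p team"  (infixl \<open>\<restriction>\<close> 90) where
  "T \<restriction> \<Phi> = (\<lambda>s. s |` \<Phi>) ` T"

definition is_local :: "'p set \<Rightarrow> 'p form \<Rightarrow> bool" where
  "is_local \<Phi> \<phi> \<longleftrightarrow>
     (\<forall>\<Psi> T. is_domain \<Psi> \<and> \<Phi> \<subseteq> \<Psi> \<and> is_team \<Psi> T \<longrightarrow> (T \<Turnstile> \<phi> \<longleftrightarrow> T \<restriction> \<Phi> \<Turnstile> \<phi>))"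

definition equivalent :: "'p form \<Rightarrow> 'p form \<Rightarrow> bool" where
  "equivalent \<phi> \<psi> \<longleftrightarrow>
     (\<forall>\<Psi> T. is_domain \<Psi> \<and> vars \<phi> \<union> vars \<psi> \<subseteq> \<Psi> \<and> is_team \<Psi> T \<longrightarrow> (T \<Turnstile> \<phi> \<longleftrightarrow> T \<Turnstile> \<psi>))"

fun lax :: "'p form \<Rightarrow> 'p form" where
  "lax (Lit a) = Lit a"
| "lax (CLit a) = CLit a"
| "lax (Conn c \<phi> \<psi>) = Conn (if c = Con_StrictOr then Con_Or else c) (lax \<phi>) (lax \<psi>)"

end

theory Submission
  imports Defs
begin

text \<open>A formula without strict splits cannot tell a team from its image under a map that keeps
  the values of its variables, so every relaxation is local. Conversely, adding fresh variables
  gives each member of a \<open>\<Phi>\<close>-team \<open>T\<close> at least as many copies as \<open>\<phi>\<close> has literals. A lax split of \<open>T\<close>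
  then lifts to a strict split of the inflated team, by sharing the copies of the doubly used
  assignments between the two sides; hence the inflated team satisfies \<open>\<phi>\<close> as soon as \<open>T\<close> satisfies
  its relaxation, and locality brings \<open>\<phi>\<close> back to \<open>T\<close>.\<close>


section \<open>Images of teams\<close>

lemma is_split_iff: "is_split T S U \<longleftrightarrow> S \<union> U = T"
  by (auto simp: is_split_def)

lemma is_strict_split_iff: "is_strict_split T S U \<longleftrightarrow> S \<union> U = T \<and> S \<inter> U = {}"
  by (simp add: is_strict_split_def is_split_iff)

lemma is_split_image_iff:
  "is_split (f ` T) S U \<longleftrightarrow> (\<exists>S' U'. is_split T S' U' \<and> S = f ` S' \<and> U = f ` U')"
proof
  assume "is_split (f ` T) S U"
  then have "is_split T (T \<inter> f -` S) (T \<inter> f -` U)"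
    "S = f ` (T \<inter> f -` S)" "U = f ` (T \<inter> f -` U)"
    by (auto simp: is_split_def)
  then show "\<exists>S' U'. is_split T S' U' \<and> S = f ` S' \<and> U = f ` U'"
    by blast
qed (auto simp: is_split_iff)

lemma is_strict_split_image_iff:
  assumes "inj_on f T"
  shows "is_strict_split (f ` T) S U \<longleftrightarrow>
    (\<exists>S' U'. is_strict_split T S' U' \<and> S = f ` S' \<and> U = f ` U')"
proof -
  have "f ` S' \<inter> f ` U' = f ` (S' \<inter> U')" if "is_split T S' U'" for S' U'
    using that assms by (simp add: is_split_def inj_on_image_Int)
  then have disjoint: "f ` S' \<inter> f ` U' = {} \<longleftrightarrow> S' \<inter> U' = {}" if "is_split T S' U'" for S' U'
    using that by simp
  have "is_strict_split (f ` T) S U \<longleftrightarrow>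
      (\<exists>S' U'. is_split T S' U' \<and> f ` S' \<inter> f ` U' = {} \<and> S = f ` S' \<and> U = f ` U')"
    by (auto simp: is_strict_split_def is_split_image_iff)
  also have "\<dots> \<longleftrightarrow> (\<exists>S' U'. is_strict_split T S' U' \<and> S = f ` S' \<and> U = f ` U')"
    by (simp add: is_strict_split_def disjoint cong: conj_cong)
  finally show ?thesis .
qed

definition preserves :: "'p set \<Rightarrow> ('p assignment \<Rightarrow> 'p assignment) \<Rightarrow> 'p team \<Rightarrow> bool" where
  "preserves V f T \<longleftrightarrow> (\<forall>s\<in>T. \<forall>p\<in>V. f s p = s p)"

lemma preserves_mono: "preserves V f T \<Longrightarrow> W \<subseteq> V \<Longrightarrow> S \<subseteq> T \<Longrightarrow> preserves W f S"
  by (auto simp: preserves_def)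

lemma preserves_restrict_map: "V \<subseteq> \<Phi> \<Longrightarrow> preserves V (\<lambda>s. s |` \<Phi>) T"
  by (auto simp: preserves_def)

lemma sat_atom_image:
  assumes "preserves (set_atom a) f T"
  shows "sat_atom (f ` T) a \<longleftrightarrow> sat_atom T a"
  using assms by (cases a) (auto simp: preserves_def)

lemma lax_lax [simp]: "lax (lax \<phi>) = lax \<phi>"
  by (induction \<phi>) auto

lemma vars_lax [simp]: "vars (lax \<phi>) = vars \<phi>"
  by (induction \<phi>) auto

lemma sat_imp_sat_lax: "T \<Turnstile> \<phi> \<Longrightarrow> T \<Turnstile> lax \<phi>"
proof (induction \<phi> arbitrary: T)
  case (Conn c \<phi> \<psi>)
  then show ?case
    by (cases c) (auto simp: is_strict_split_def)
qed auto

lemma PL_vars: "\<phi> \<in> PL \<Sigma> \<Phi> \<Longrightarrow> vars \<phi> \<subseteq> \<Phi>"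
  by (induction rule: PL.induct) auto

text \<open>The condition \<open>lax \<phi> = \<phi>\<close> says that no strict split occurs in \<open>\<phi>\<close>.\<close>

lemma sat_image:
  assumes "preserves (vars \<phi>) f T" and "inj_on f T \<or> lax \<phi> = \<phi>"
  shows "f ` T \<Turnstile> \<phi> \<longleftrightarrow> T \<Turnstile> \<phi>"
  using assms
proof (induction \<phi> arbitrary: T)
  case (Conn c \<phi> \<psi>)
  have IH: "f ` S \<Turnstile> \<phi> \<longleftrightarrow> S \<Turnstile> \<phi>" "f ` S \<Turnstile> \<psi> \<longleftrightarrow> S \<Turnstile> \<psi>" if "S \<subseteq> T" for S
  proof -
    have "preserves (vars \<phi>) f S" "preserves (vars \<psi>) f S"
      using preserves_mono[OF Conn.prems(1) _ that] by auto
    moreover have "inj_on f S \<or> lax \<phi> = \<phi>" "inj_on f S \<or> lax \<psi> = \<psi>"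
      using Conn.prems(2) inj_on_subset[OF _ that] by auto
    ultimately show "f ` S \<Turnstile> \<phi> \<longleftrightarrow> S \<Turnstile> \<phi>" "f ` S \<Turnstile> \<psi> \<longleftrightarrow> S \<Turnstile> \<psi>"
      using Conn.IH by blast+
  qed
  show ?case
  proof (cases c)
    case Con_Or
    have "f ` T \<Turnstile> Conn c \<phi> \<psi> \<longleftrightarrow> (\<exists>S U. is_split T S U \<and> f ` S \<Turnstile> \<phi> \<and> f ` U \<Turnstile> \<psi>)"
      unfolding Con_Or sat.simps is_split_image_iff by blast
    also have "\<dots> \<longleftrightarrow> T \<Turnstile> Conn c \<phi> \<psi>"
      using IH unfolding Con_Or sat.simps is_split_def by blast
    finally show ?thesis .
  next
    case Con_StrictOr
    then have inj: "inj_on f T"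
      using Conn.prems(2) by simp
    have "f ` T \<Turnstile> Conn c \<phi> \<psi> \<longleftrightarrow>
        (\<exists>S U. is_strict_split T S U \<and> f ` S \<Turnstile> \<phi> \<and> f ` U \<Turnstile> \<psi>)"
      unfolding Con_StrictOr sat.simps is_strict_split_image_iff[OF inj] by blast
    also have "\<dots> \<longleftrightarrow> T \<Turnstile> Conn c \<phi> \<psi>"
      using IH unfolding Con_StrictOr sat.simps is_strict_split_def is_split_def by blast
    finally show ?thesis .
  qed (simp_all add: IH)
qed (simp_all add: sat_atom_image)

lemma is_local_lax: "vars \<phi> \<subseteq> \<Phi> \<Longrightarrow> is_local \<Phi> (lax \<phi>)"
  by (simp add: is_local_def team_restrict_def sat_image preserves_restrict_map)


section \<open>Equivalence and locality\<close>

text \<open>Equivalence concerns every domain containing the variables of the formulas, whereas locality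
  over \<open>\<Phi>\<close> speaks only about domains above \<open>\<Phi>\<close>; padding bridges the gap.\<close>

definition pad :: "'p set \<Rightarrow> 'p assignment \<Rightarrow> 'p assignment" where
  "pad \<Phi> s = (\<lambda>_. Some True) |` \<Phi> ++ s"

lemma is_team_pad: "is_team \<Psi> T \<Longrightarrow> is_team (\<Phi> \<union> \<Psi>) (pad \<Phi> ` T)"
  by (auto simp: is_team_def pad_def)

lemma preserves_pad: "is_team \<Psi> T \<Longrightarrow> V \<subseteq> \<Psi> \<Longrightarrow> preserves V (pad \<Phi>) T"
  by (auto simp: preserves_def is_team_def pad_def map_add_dom_app_simps)

lemma inj_on_pad:
  assumes "is_team \<Psi> T"
  shows "inj_on (pad \<Phi>) T"
proof (rule inj_on_inverseI)
  fix s assume "s \<in> T"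
  then have "dom s = \<Psi>"
    using assms by (simp add: is_team_def)
  then have "(pad \<Phi> s |` \<Psi>) p = s p" for p
    by (cases "p \<in> dom s") (auto simp: pad_def restrict_map_def map_add_dom_app_simps)
  then show "pad \<Phi> s |` \<Psi> = s" ..
qed

lemma equivalent_if_large_domains:
  assumes "is_domain \<Phi>"
    and large: "\<And>\<Psi> T. is_domain \<Psi> \<Longrightarrow> \<Phi> \<subseteq> \<Psi> \<Longrightarrow> is_team \<Psi> T \<Longrightarrow> T \<Turnstile> \<phi> \<longleftrightarrow> T \<Turnstile> \<psi>"
  shows "equivalent \<phi> \<psi>"
  unfolding equivalent_def
proof (intro allI impI, elim conjE)
  fix \<Psi> T assume \<Psi>: "is_domain \<Psi>" "vars \<phi> \<union> vars \<psi> \<subseteq> \<Psi>" and T: "is_team \<Psi> T"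
  have pad: "pad \<Phi> ` T \<Turnstile> \<chi> \<longleftrightarrow> T \<Turnstile> \<chi>" if "vars \<chi> \<subseteq> \<Psi>" for \<chi>
    using that T by (simp add: sat_image preserves_pad inj_on_pad)
  have "is_domain (\<Phi> \<union> \<Psi>)"
    using assms(1) \<Psi>(1) by (simp add: is_domain_def)
  then have "pad \<Phi> ` T \<Turnstile> \<phi> \<longleftrightarrow> pad \<Phi> ` T \<Turnstile> \<psi>"
    using large is_team_pad[OF T] by blast
  then show "T \<Turnstile> \<phi> \<longleftrightarrow> T \<Turnstile> \<psi>"
    using pad \<Psi>(2) by simp
qed

lemma is_localD:
  "is_local \<Phi> \<phi> \<Longrightarrow> is_domain \<Psi> \<Longrightarrow> \<Phi> \<subseteq> \<Psi> \<Longrightarrow> is_team \<Psi> T \<Longrightarrow> T \<Turnstile> \<phi> \<longleftrightarrow> T \<restriction> \<Phi> \<Turnstile> \<phi>"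
  by (auto simp: is_local_def)

lemma is_team_restrict: "is_team \<Psi> T \<Longrightarrow> \<Phi> \<subseteq> \<Psi> \<Longrightarrow> is_team \<Phi> (T \<restriction> \<Phi>)"
  by (auto simp: is_team_def team_restrict_def)

lemma equivalent_if_is_local:
  assumes \<Phi>: "is_domain \<Phi>" and local: "is_local \<Phi> \<phi>" "is_local \<Phi> \<psi>"
    and agree: "\<And>T. is_team \<Phi> T \<Longrightarrow> T \<Turnstile> \<phi> \<longleftrightarrow> T \<Turnstile> \<psi>"
  shows "equivalent \<phi> \<psi>"
proof (rule equivalent_if_large_domains[OF \<Phi>])
  fix \<Psi> T assume \<Psi>: "is_domain \<Psi>" "\<Phi> \<subseteq> \<Psi>" "is_team \<Psi> T"
  have "T \<Turnstile> \<phi> \<longleftrightarrow> T \<restriction> \<Phi> \<Turnstile> \<phi>"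
    using local(1) \<Psi> by (rule is_localD)
  also have "\<dots> \<longleftrightarrow> T \<restriction> \<Phi> \<Turnstile> \<psi>"
    using agree is_team_restrict[OF \<Psi>(3,2)] .
  also have "\<dots> \<longleftrightarrow> T \<Turnstile> \<psi>"
    using is_localD[OF local(2) \<Psi>] ..
  finally show "T \<Turnstile> \<phi> \<longleftrightarrow> T \<Turnstile> \<psi>" .
qed

lemma is_local_if_equivalent:
  assumes \<Phi>: "is_domain \<Phi>" "vars \<phi> \<union> vars \<psi> \<subseteq> \<Phi>"
    and equiv: "equivalent \<phi> \<psi>" and local: "is_local \<Phi> \<psi>"
  shows "is_local \<Phi> \<phi>"
  unfolding is_local_def
proof (intro allI impI, elim conjE)
  have agree: "T \<Turnstile> \<phi> \<longleftrightarrow> T \<Turnstile> \<psi>" if "is_domain \<Psi>" "\<Phi> \<subseteq> \<Psi>" "is_team \<Psi> T" for \<Psi> T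
    using equiv \<Phi>(2) that unfolding equivalent_def by (meson subset_trans)
  fix \<Psi> T assume \<Psi>: "is_domain \<Psi>" "\<Phi> \<subseteq> \<Psi>" "is_team \<Psi> T"
  have "T \<Turnstile> \<phi> \<longleftrightarrow> T \<Turnstile> \<psi>"
    using \<Psi> by (rule agree)
  also have "\<dots> \<longleftrightarrow> T \<restriction> \<Phi> \<Turnstile> \<psi>"
    using local \<Psi> by (rule is_localD)
  also have "\<dots> \<longleftrightarrow> T \<restriction> \<Phi> \<Turnstile> \<phi>"
    using agree[OF \<Phi>(1) order_refl is_team_restrict[OF \<Psi>(3,2)]] ..
  finally show "T \<Turnstile> \<phi> \<longleftrightarrow> T \<restriction> \<Phi> \<Turnstile> \<phi>" .
qed


section \<open>Lifting splits along multiple covers\<close>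

definition fibre :: "('a \<Rightarrow> 'b) \<Rightarrow> 'a set \<Rightarrow> 'b \<Rightarrow> 'a set" where
  "fibre f X y = {x \<in> X. f x = y}"

text \<open>For \<open>k > 0\<close> the fibres are finite, because infinite sets have \<open>card\<close> zero.\<close>

definition multicover :: "nat \<Rightarrow> ('a \<Rightarrow> 'b) \<Rightarrow> 'a set \<Rightarrow> 'b set \<Rightarrow> bool" where
  "multicover k f X Y \<longleftrightarrow> f ` X = Y \<and> (\<forall>y\<in>Y. k \<le> card (fibre f X y))"

lemma multicover_mono: "multicover k f X Y \<Longrightarrow> j \<le> k \<Longrightarrow> multicover j f X Y"
  by (fastforce simp: multicover_def)

lemma multicoverI:
  assumes "f ` X \<subseteq> Y" and "0 < k" and fibres: "\<And>y. y \<in> Y \<Longrightarrow> k \<le> card (fibre f X y)"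
  shows "multicover k f X Y"
proof -
  have "y \<in> f ` X" if "y \<in> Y" for y
  proof -
    have "fibre f X y \<noteq> {}"
      using fibres[OF that] \<open>0 < k\<close> by auto
    then show ?thesis
      by (auto simp: fibre_def)
  qed
  then show ?thesis
    using assms by (auto simp: multicover_def)
qed

lemma obtain_subset_with_card_fibres:
  assumes "multicover k f X Y"
  obtains H where "H \<subseteq> X" and "\<And>y. y \<in> Y \<Longrightarrow> card (fibre f H y) = k"
proof -
  have "\<exists>F \<subseteq> fibre f X y. card F = k" if "y \<in> Y" for y
    using assms that by (metis multicover_def obtain_subset_with_card_n)
  then obtain F where F: "F y \<subseteq> fibre f X y" "card (F y) = k" if "y \<in> Y" for y
    by metis
  show ?thesis
  proof
    show "(\<Union>y\<in>Y. F y) \<subseteq> X"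
      using F(1) by (auto simp: fibre_def)
    fix y assume "y \<in> Y"
    then have "fibre f (\<Union>y\<in>Y. F y) y = F y"
      using F(1) by (auto simp: fibre_def)
    then show "card (fibre f (\<Union>y\<in>Y. F y) y) = k"
      using F(2) \<open>y \<in> Y\<close> by simp
  qed
qed

lemma multicover_lift_split:
  assumes cover: "multicover (a + b) f X (Y \<union> Z)" and pos: "0 < a" "0 < b"
  obtains Y' Z' where "Y' \<union> Z' = X" and "Y' \<inter> Z' = {}"
    and "multicover a f Y' Y" and "multicover b f Z' Z"
proof -
  obtain H where "H \<subseteq> X" and card_H: "\<And>y. y \<in> Y \<union> Z \<Longrightarrow> card (fibre f H y) = a"
    by (rule obtain_subset_with_card_fibres[OF multicover_mono[OF cover le_add1]]) blast
  have image: "f ` X = Y \<union> Z"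
    and card_X: "\<And>y. y \<in> Y \<union> Z \<Longrightarrow> a + b \<le> card (fibre f X y)"
    using cover by (auto simp: multicover_def)
  define Y' where "Y' = {x \<in> X. f x \<in> Y \<and> (f x \<in> Z \<longrightarrow> x \<in> H)}"
  show ?thesis
  proof
    show "multicover a f Y' Y"
    proof (rule multicoverI)
      fix y assume y: "y \<in> Y"
      then have "fibre f Y' y = (if y \<in> Z then fibre f H y else fibre f X y)"
        using \<open>H \<subseteq> X\<close> by (auto simp: Y'_def fibre_def)
      then show "a \<le> card (fibre f Y' y)"
        using card_H[of y] card_X[of y] y by simp
    qed (use pos in \<open>auto simp: Y'_def\<close>)
    show "multicover b f (X - Y') Z"
    proof (rule multicoverI)
      fix z assume z: "z \<in> Z"
      then have "fibre f (X - Y') z = (if z \<in> Y then fibre f X z - fibre f H z else fibre f X z)"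
        by (auto simp: Y'_def fibre_def)
      moreover have "card (fibre f X z) - card (fibre f H z) \<le> card (fibre f X z - fibre f H z)"
        by (rule diff_card_le_card_Diff) (use card_H[of z] z pos in \<open>auto intro: card_ge_0_finite\<close>)
      ultimately show "b \<le> card (fibre f (X - Y') z)"
        using card_H[of z] card_X[of z] z by (cases "z \<in> Y") simp_all
    qed (use image pos in \<open>auto simp: Y'_def\<close>)
  qed (auto simp: Y'_def)
qed

text \<open>\<open>Suc (size \<phi>)\<close> is the number of literal occurrences in \<open>\<phi>\<close>.\<close>

lemma sat_if_multicover_sat_lax:
  assumes "preserves (vars \<phi>) f T" and "multicover (Suc (size \<phi>)) f T T'" and "T' \<Turnstile> lax \<phi>"
  shows "T \<Turnstile> \<phi>"
  using assms
proof (induction \<phi> arbitrary: T T')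
  case (Conn c \<phi> \<psi>)
  have preserves: "preserves (vars \<phi>) f S" "preserves (vars \<psi>) f S" if "S \<subseteq> T" for S
    using preserves_mono[OF Conn.prems(1) _ that] by auto
  have "multicover (Suc (size \<phi>)) f T T'" "multicover (Suc (size \<psi>)) f T T'"
    using Conn.prems(2) by (auto elim: multicover_mono)
  then have pointwise: "T' \<Turnstile> lax \<phi> \<Longrightarrow> T \<Turnstile> \<phi>" "T' \<Turnstile> lax \<psi> \<Longrightarrow> T \<Turnstile> \<psi>"
    using Conn.IH preserves by blast+
  have strict_split: "\<exists>S U. is_strict_split T S U \<and> S \<Turnstile> \<phi> \<and> U \<Turnstile> \<psi>"
    if "T' \<Turnstile> Conn Con_Or (lax \<phi>) (lax \<psi>)"
  proof -
    obtain S' U' where T': "T' = S' \<union> U'" and sat: "S' \<Turnstile> lax \<phi>" "U' \<Turnstile> lax \<psi>"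
      using \<open>T' \<Turnstile> Conn Con_Or _ _\<close> by (auto simp: is_split_iff)
    have "multicover (Suc (size \<phi>) + Suc (size \<psi>)) f T (S' \<union> U')"
      using Conn.prems(2) T' by simp
    then obtain S U where split: "S \<union> U = T" "S \<inter> U = {}"
      and "multicover (Suc (size \<phi>)) f S S'" "multicover (Suc (size \<psi>)) f U U'"
      by (rule multicover_lift_split) simp_all
    then have "S \<Turnstile> \<phi>" "U \<Turnstile> \<psi>"
      using Conn.IH(1)[OF preserves(1) _ sat(1)] Conn.IH(2)[OF preserves(2) _ sat(2)] by blast+
    then show ?thesis
      using split by (auto simp: is_strict_split_iff)
  qed
  show ?case
  proof (cases c)
    case Con_Or
    then show ?thesis
      using strict_split Conn.prems(3) unfolding is_strict_split_def by fastforce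
  next
    case Con_StrictOr
    then show ?thesis
      using strict_split Conn.prems(3) by simp
  qed (use pointwise Conn.prems(3) in auto)
qed (auto simp: multicover_def sat_atom_image)


section \<open>Inflating a team by fresh variables\<close>

definition extend_team :: "'p set \<Rightarrow> 'p set \<Rightarrow> 'p team \<Rightarrow> 'p team" where
  "extend_team \<Psi> \<Phi> T = {s. dom s = \<Psi> \<and> s |` \<Phi> \<in> T}"

lemma card_extensions:
  fixes t :: "'p assignment"
  assumes "finite \<Psi>" and "dom t \<subseteq> \<Psi>"
  shows "card {s. dom s = \<Psi> \<and> s |` dom t = t} = 2 ^ card (\<Psi> - dom t)"
proof -
  let ?N = "\<Psi> - dom t"
  let ?f = "\<lambda>A. t ++ (\<lambda>p. Some (p \<in> A)) |` ?N"
  let ?g = "\<lambda>s. {p \<in> ?N. s p = Some True}"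
  have "bij_betw ?f (Pow ?N) {s. dom s = \<Psi> \<and> s |` dom t = t}"
  proof (rule bij_betw_byWitness[where f' = ?g])
    show "\<forall>A\<in>Pow ?N. ?g (?f A) = A"
      by (auto simp: map_add_def restrict_map_def)
    have "?f (?g s) p = s p" if "dom s = \<Psi>" "s |` dom t = t" for s p
    proof (cases "p \<in> dom t")
      case True
      then show ?thesis
        using fun_cong[OF that(2), of p] by (simp add: map_add_def)
    next
      case False
      then show ?thesis
        using that(1) by (cases "s p") (auto simp: map_add_def restrict_map_def dom_def)
    qed
    then show "\<forall>s\<in>{s. dom s = \<Psi> \<and> s |` dom t = t}. ?f (?g s) = s"
      by auto
    show "?f ` Pow ?N \<subseteq> {s. dom s = \<Psi> \<and> s |` dom t = t}"
      using assms(2) by (fastforce simp: map_add_def restrict_map_def fun_eq_iff dom_def)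
  qed auto
  then show ?thesis
    using assms(1) by (simp add: card_Pow flip: bij_betw_same_card)
qed

lemma multicover_extend_team:
  assumes "is_team \<Phi> T" and "finite \<Psi>" and "\<Phi> \<subseteq> \<Psi>"
  shows "multicover (2 ^ card (\<Psi> - \<Phi>)) (\<lambda>s. s |` \<Phi>) (extend_team \<Psi> \<Phi> T) T"
proof (rule multicoverI)
  fix t assume t: "t \<in> T"
  then have "dom t = \<Phi>"
    using assms(1) by (simp add: is_team_def)
  moreover have "fibre (\<lambda>s. s |` \<Phi>) (extend_team \<Psi> \<Phi> T) t = {s. dom s = \<Psi> \<and> s |` \<Phi> = t}"
    using t by (auto simp: fibre_def extend_team_def)
  ultimately show "2 ^ card (\<Psi> - \<Phi>) \<le> card (fibre (\<lambda>s. s |` \<Phi>) (extend_team \<Psi> \<Phi> T) t)"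
    using card_extensions[of \<Psi> t] assms by simp
qed (auto simp: extend_team_def)

lemma sat_iff_sat_lax_if_is_local:
  fixes \<phi> :: "'p form"
  assumes "infinite (UNIV :: 'p set)" and "is_domain \<Phi>" and "vars \<phi> \<subseteq> \<Phi>"
    and local: "is_local \<Phi> \<phi>" and T: "is_team \<Phi> T"
  shows "T \<Turnstile> \<phi> \<longleftrightarrow> T \<Turnstile> lax \<phi>"
proof
  assume sat: "T \<Turnstile> lax \<phi>"
  have "finite \<Phi>"
    using assms(2) by (simp add: is_domain_def)
  then have "infinite (- \<Phi>)"
    using assms(1) by (simp add: Compl_eq_Diff_UNIV)
  then obtain N where N: "N \<subseteq> - \<Phi>" "finite N" "card N = size \<phi>"
    using infinite_arbitrarily_large by blast
  define T' where "T' = extend_team (\<Phi> \<union> N) \<Phi> T"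
  have "\<Phi> \<union> N - \<Phi> = N"
    using N(1) by auto
  then have cover: "multicover (2 ^ size \<phi>) (\<lambda>s. s |` \<Phi>) T' T"
    using multicover_extend_team[OF T, of "\<Phi> \<union> N"] \<open>finite \<Phi>\<close> N by (simp add: T'_def)
  have "multicover (Suc (size \<phi>)) (\<lambda>s. s |` \<Phi>) T' T"
    by (rule multicover_mono[OF cover]) (simp add: Suc_leI)
  then have "T' \<Turnstile> \<phi>"
    using sat_if_multicover_sat_lax preserves_restrict_map assms(3) sat by blast
  moreover have "is_domain (\<Phi> \<union> N)" "is_team (\<Phi> \<union> N) T'"
    using \<open>finite \<Phi>\<close> N(2) by (simp_all add: is_domain_def is_team_def T'_def extend_team_def)
  ultimately have "T' \<restriction> \<Phi> \<Turnstile> \<phi>"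
    using is_localD[OF local] by blast
  then show "T \<Turnstile> \<phi>"
    using cover by (simp add: team_restrict_def multicover_def)
qed (rule sat_imp_sat_lax)

theorem theorem3p16:
  fixes \<Phi> :: "'p set" and \<phi> :: "'p form"
  assumes "infinite (UNIV :: 'p set)"
    and "is_domain \<Phi>"
    and "\<phi> \<in> PL {Con_BoolOr, Con_And, Con_Or, Con_StrictOr} \<Phi>"
  shows "is_local \<Phi> \<phi> \<longleftrightarrow> equivalent \<phi> (lax \<phi>)"
proof -
  have vars: "vars \<phi> \<subseteq> \<Phi>"
    using assms(3) by (rule PL_vars)
  then have local_lax: "is_local \<Phi> (lax \<phi>)"
    by (rule is_local_lax)
  show ?thesis
  proof
    assume local: "is_local \<Phi> \<phi>"
    then have "T \<Turnstile> \<phi> \<longleftrightarrow> T \<Turnstile> lax \<phi>" if "is_team \<Phi> T" for T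
      using sat_iff_sat_lax_if_is_local assms(1,2) vars that by blast
    then show "equivalent \<phi> (lax \<phi>)"
      by (rule equivalent_if_is_local[OF assms(2) local local_lax])
  next
    assume "equivalent \<phi> (lax \<phi>)"
    then show "is_local \<Phi> \<phi>"
      using vars by (intro is_local_if_equivalent[OF assms(2) _ _ local_lax]) simp_all
  qed
qed

end
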